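(* Let $f,g,\phi$ satisfy the composite smoothness assumption and the bounded domain assumption for some $\Omega\ge0$, let the saddle-subdifferential operator $M=(\nabla_u\phi+\partial f,\,-\nabla_v\phi+\partial g)$ of the problem $\min_{u}\max_{v}\{f(u)+\phi(u,v)-g(v)\}$ satisfy the strong MVI condition for $\mu\ge0$, let $\tau\in\big(0,\frac{1}{L+\hat L}\big)$ and let $x_*\in S_*^\mu(M)$. Then the SA-MGDA method achieves $D_h(x_*,x_k)\le\epsilon$ with $k=O(\log(\epsilon^{-1}))$ outer iterations and $J=O(\log(\epsilon^{-1}))$ inner iterations (per outer iteration), requiring in total $O(\log^2(\epsilon^{-1}))$ gradient computations.
   Context: Let $d=d_u+d_v$, $x=(u,v)\in\mathbb{R}^{d_u}\times\mathbb{R}^{d_v}=\mathbb{R}^d$ with Euclidean inner product and norm. The $O(\cdot)$ is as $\epsilon\to0^+$, with the problem data, $\tau$ and the initial point fixed. Composite smoothness assumption: $f:\mathbb{R}^{d_u}\to(-\infty,\infty]$ and $g:\mathbb{R}^{d_v}\to(-\infty,\infty]$ are closed, proper and convex; $\phi:\mathbb{R}^d\to\mathbb{R}$ is continuously differentiable and there are $L_{uu},L_{uv},L_{vu},L_{vv}>0$ with $\|\nabla_u\phi(u,v)-\nabla_u\phi(\bar u,\bar v)\|\le L_{uu}\|u-\bar u\|+L_{uv}\|v-\bar v\|$ and $\|\nabla_v\phi(u,v)-\nabla_v\phi(\bar u,\bar v)\|\le L_{vu}\|u-\bar u\|+L_{vv}\|v-\bar v\|$ for all $u,\bar u,v,\bar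 v$. $L>0$ denotes a Lipschitz constant of $\nabla\phi$ (equivalently of $(\nabla_u\phi,-\nabla_v\phi)$) on $\mathbb{R}^d$, and $\hat L=\max\{L_{uu},L_{vv}\}$. Bounded domain assumption: $\|x-y\|\le\Omega$ for all $x,y\in\operatorname{dom}f\times\operatorname{dom}g$. $\operatorname{gra}M=\{(x,w):w\in Mx\}$; $X_*(M)=\{x_*:0\in Mx_*\}$ (assumed nonempty). Strong MVI condition with $\mu\ge0$: there exists $x_*\in X_*(M)$ such that $\langle x-x_*,w\rangle\ge\mu\|x-x_*\|^2$ for all $(x,w)\in\operatorname{gra}M$. $S_*^\mu(M)$ is the set of all $x_*\in X_*(M)$ with this property. Let $h(u,v)=\frac{1}{2\tau}(\|u\|^2+\|v\|^2)-\phi(u,v)$ and $D_h(x,y)=h(x)-h(y)-\langle\nabla h(y),x-y\rangle$. SA-MGDA with finite $J\ge1$: let $\eta=\frac{\tau}{1+2L_{vv}\tau}$ and $\operatorname{prox}_\psi=(I+\partial\psi)^{-1}$. From an initial point $x_0=(u_0,v_0)$, for outer iterations $k=0,1,\dots$: set $u_{k+1}=\operatorname{prox}_{\tau f}[u_k-\tau\nabla_u\phi(u_k,v_k)]$ and $v_{k,0}=v_k$; for inner iterations $j=0,\dots,J-1$ set $v_{k,j+1}=\operatorname{prox}_{\eta g}\big[\frac\eta\tau(v_k-\tau\nabla_v\phi(u_k,v_k))+2\eta L_{vv}\big(v_{k,j}+\frac1{L_{vv}}\nabla_v\phi(u_{k+1},v_{k,j})\big)\big]$; then $v_{k+1}=v_{k,J}$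 and $x_{k+1}=(u_{k+1},v_{k+1})$. A gradient computation is an evaluation of $\nabla_u\phi$ or $\nabla_v\phi$ at a point.
   Formalization: The formal theorem assumes μ>0 rather than μ≥0; for μ=0 the claim fails, e.g. φ=0, f and g both the indicator of [-1,1], x_*=(0,0), x_0=(1,1), where SA-MGDA never moves. *)

theory Defs
  imports
    "HOL-Analysis.Analysis"
    "HOL-Library.Landau_Symbols"
    "HOL-Library.State_Monad"
begin

text \<open>
  The spaces of \<open>u\<close> and \<open>v\<close> are types of class \<^class>\<open>euclidean_space\<close>; the inner product and norm
  of the product type are the Euclidean ones.
\<close>

section \<open>Extended-real-valued convex functions\<close>

definition edom :: "('a \<Rightarrow> ereal) \<Rightarrow> 'a set" where
  "edom f = {x. f x < \<infinity>}"

definition epi :: "('a \<Rightarrow> ereal) \<Rightarrow> ('a \<times> real) set" where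
  "epi f = {(x, r). f x \<le> ereal r}"

definition closed_proper_convex :: "('a::euclidean_space \<Rightarrow> ereal) \<Rightarrow> bool" where
  "closed_proper_convex f \<longleftrightarrow>
     closed (epi f) \<and> (\<forall>x. f x \<noteq> -\<infinity>) \<and> edom f \<noteq> {} \<and> convex (epi f)"

text \<open>For proper \<open>f\<close> the subdifferential below is empty outside \<^term>\<open>edom f\<close>.\<close>

definition subdiff :: "('a::euclidean_space \<Rightarrow> ereal) \<Rightarrow> 'a \<Rightarrow> 'a set" where
  "subdiff f x = {s. \<forall>y. f x + ereal (s \<bullet> (y - x)) \<le> f y}"

text \<open>
  The resolvent \<open>(I + \<partial>\<psi>)\<^sup>-\<^sup>1\<close>; it is single-valued with full domain when \<open>\<psi>\<close> is closed, proper
  and convex, which justifies the definite description.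
\<close>

definition prox :: "('a::euclidean_space \<Rightarrow> ereal) \<Rightarrow> 'a \<Rightarrow> 'a" where
  "prox \<psi> z = (THE p. \<exists>s\<in>subdiff \<psi> p. z = p + s)"

section \<open>Gradients and Bregman distances\<close>

definition grad :: "('a::real_inner \<Rightarrow> real) \<Rightarrow> 'a \<Rightarrow> 'a" where
  "grad F x = (THE D. GDERIV F x :> D)"

definition grad_u :: "('u::euclidean_space \<times> 'v::euclidean_space \<Rightarrow> real) \<Rightarrow> 'u \<times> 'v \<Rightarrow> 'u" where
  "grad_u \<phi> x = grad (\<lambda>u. \<phi> (u, snd x)) (fst x)"

definition grad_v :: "('u::euclidean_space \<times> 'v::euclidean_space \<Rightarrow> real) \<Rightarrow> 'u \<times> 'v \<Rightarrow> 'v" where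
  "grad_v \<phi> x = grad (\<lambda>v. \<phi> (fst x, v)) (snd x)"

definition h_fun :: "real \<Rightarrow> ('u::euclidean_space \<times> 'v::euclidean_space \<Rightarrow> real) \<Rightarrow> 'u \<times> 'v \<Rightarrow> real" where
  "h_fun \<tau> \<phi> = (\<lambda>(u, v). 1 / (2 * \<tau>) * ((norm u)\<^sup>2 + (norm v)\<^sup>2) - \<phi> (u, v))"

definition bregman :: "('a::real_inner \<Rightarrow> real) \<Rightarrow> 'a \<Rightarrow> 'a \<Rightarrow> real" where
  "bregman h x y = h x - h y - grad h y \<bullet> (x - y)"

section \<open>Assumptions\<close>

definition composite_smooth ::
  "('u::euclidean_space \<Rightarrow> ereal) \<Rightarrow> ('v::euclidean_space \<Rightarrow> ereal) \<Rightarrow> ('u \<times> 'v \<Rightarrow> real) \<Rightarrow>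
   real \<Rightarrow> real \<Rightarrow> real \<Rightarrow> real \<Rightarrow> bool" where
  "composite_smooth f g \<phi> L\<^sub>u\<^sub>u L\<^sub>u\<^sub>v L\<^sub>v\<^sub>u L\<^sub>v\<^sub>v \<longleftrightarrow>
     closed_proper_convex f \<and> closed_proper_convex g \<and>
     (\<forall>x. \<phi> differentiable (at x)) \<and> continuous_on UNIV (grad \<phi>) \<and>
     L\<^sub>u\<^sub>u > 0 \<and> L\<^sub>u\<^sub>v > 0 \<and> L\<^sub>v\<^sub>u > 0 \<and> L\<^sub>v\<^sub>v > 0 \<and>
     (\<forall>u u' v v'.
        norm (grad_u \<phi> (u, v) - grad_u \<phi> (u', v')) \<le> L\<^sub>u\<^sub>u * norm (u - u') + L\<^sub>u\<^sub>v * norm (v - v') \<and>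
        norm (grad_v \<phi> (u, v) - grad_v \<phi> (u', v')) \<le> L\<^sub>v\<^sub>u * norm (u - u') + L\<^sub>v\<^sub>v * norm (v - v'))"

definition bounded_domain ::
  "('u::euclidean_space \<Rightarrow> ereal) \<Rightarrow> ('v::euclidean_space \<Rightarrow> ereal) \<Rightarrow> real \<Rightarrow> bool" where
  "bounded_domain f g \<Omega> \<longleftrightarrow>
     (\<forall>x \<in> edom f \<times> edom g. \<forall>y \<in> edom f \<times> edom g. norm (x - y) \<le> \<Omega>)"

definition saddle_op ::
  "('u::euclidean_space \<Rightarrow> ereal) \<Rightarrow> ('v::euclidean_space \<Rightarrow> ereal) \<Rightarrow> ('u \<times> 'v \<Rightarrow> real) \<Rightarrow>
   'u \<times> 'v \<Rightarrow> ('u \<times> 'v) set" where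
  "saddle_op f g \<phi> x =
     {(grad_u \<phi> x + s, - grad_v \<phi> x + t) | s t. s \<in> subdiff f (fst x) \<and> t \<in> subdiff g (snd x)}"

definition gra :: "('a \<Rightarrow> 'a set) \<Rightarrow> ('a \<times> 'a) set" where
  "gra M = {(x, w). w \<in> M x}"

definition X_star :: "('a::real_inner \<Rightarrow> 'a set) \<Rightarrow> 'a set" where
  "X_star M = {x. 0 \<in> M x}"

definition S_star :: "real \<Rightarrow> ('a::real_inner \<Rightarrow> 'a set) \<Rightarrow> 'a set" where
  "S_star \<mu> M =
     {x\<^sub>s \<in> X_star M. \<forall>(x, w) \<in> gra M. (x - x\<^sub>s) \<bullet> w \<ge> \<mu> * (norm (x - x\<^sub>s))\<^sup>2}"

text \<open>
  The condition allows \<open>\<mu> = 0\<close>, but a linear rate needs \<open>\<mu> > 0\<close>: for \<open>\<phi> = 0\<close> and \<open>f\<close>, \<open>g\<close> both the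
  indicator function of \<open>[-1, 1]\<close>, it holds at every point of the square with \<open>\<mu> = 0\<close>, while SA-MGDA
  stays at any starting point in the square.
\<close>

definition strong_MVI :: "real \<Rightarrow> ('a::real_inner \<Rightarrow> 'a set) \<Rightarrow> bool" where
  "strong_MVI \<mu> M \<longleftrightarrow> \<mu> \<ge> 0 \<and>
     (\<exists>x\<^sub>s \<in> X_star M. \<forall>(x, w) \<in> gra M. (x - x\<^sub>s) \<bullet> w \<ge> \<mu> * (norm (x - x\<^sub>s))\<^sup>2)"

section \<open>SA-MGDA\<close>

text \<open>
  The method is a computation over a counter (the \<^typ>\<open>nat\<close> state) that is incremented at every
  evaluation of a partial gradient. Every occurrence of a gradient in the iteration formulas is
  evaluated and counted, including \<open>\<nabla>\<^sub>v \<phi>(u\<^sub>k, v\<^sub>k)\<close> anew in every inner iteration; reusing it could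
  only lower the count.
\<close>

definition evaluate :: "('a \<Rightarrow> 'b) \<Rightarrow> 'a \<Rightarrow> (nat, 'b) state" where
  "evaluate G x = State (\<lambda>n. (G x, Suc n))"

primrec inner_loop ::
  "('v::euclidean_space \<Rightarrow> ereal) \<Rightarrow> ('u::euclidean_space \<times> 'v \<Rightarrow> real) \<Rightarrow> real \<Rightarrow> real \<Rightarrow>
   'u \<times> 'v \<Rightarrow> 'u \<Rightarrow> nat \<Rightarrow> (nat, 'v) state" where
  "inner_loop g \<phi> L\<^sub>v\<^sub>v \<tau> x\<^sub>k u' 0 = State_Monad.return (snd x\<^sub>k)"
| "inner_loop g \<phi> L\<^sub>v\<^sub>v \<tau> x\<^sub>k u' (Suc j) = do {
     w \<leftarrow> inner_loop g \<phi> L\<^sub>v\<^sub>v \<tau> x\<^sub>k u' j;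
     a \<leftarrow> evaluate (grad_v \<phi>) x\<^sub>k;
     b \<leftarrow> evaluate (grad_v \<phi>) (u', w);
     let \<eta> = \<tau> / (1 + 2 * L\<^sub>v\<^sub>v * \<tau>);
     State_Monad.return (prox (\<lambda>v. ereal \<eta> * g v)
       ((\<eta> / \<tau>) *\<^sub>R (snd x\<^sub>k - \<tau> *\<^sub>R a) + (2 * \<eta> * L\<^sub>v\<^sub>v) *\<^sub>R (w + (1 / L\<^sub>v\<^sub>v) *\<^sub>R b)))
   }"

primrec sa_mgda ::
  "('u::euclidean_space \<Rightarrow> ereal) \<Rightarrow> ('v::euclidean_space \<Rightarrow> ereal) \<Rightarrow> ('u \<times> 'v \<Rightarrow> real) \<Rightarrow>
   real \<Rightarrow> real \<Rightarrow> nat \<Rightarrow> 'u \<times> 'v \<Rightarrow> nat \<Rightarrow> (nat, 'u \<times> 'v) state" where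
  "sa_mgda f g \<phi> L\<^sub>v\<^sub>v \<tau> J x\<^sub>0 0 = State_Monad.return x\<^sub>0"
| "sa_mgda f g \<phi> L\<^sub>v\<^sub>v \<tau> J x\<^sub>0 (Suc k) = do {
     x\<^sub>k \<leftarrow> sa_mgda f g \<phi> L\<^sub>v\<^sub>v \<tau> J x\<^sub>0 k;
     c \<leftarrow> evaluate (grad_u \<phi>) x\<^sub>k;
     let u' = prox (\<lambda>u. ereal \<tau> * f u) (fst x\<^sub>k - \<tau> *\<^sub>R c);
     v' \<leftarrow> inner_loop g \<phi> L\<^sub>v\<^sub>v \<tau> x\<^sub>k u' J;
     State_Monad.return (u', v')
   }"

definition sa_mgda_iterate ::
  "('u::euclidean_space \<Rightarrow> ereal) \<Rightarrow> ('v::euclidean_space \<Rightarrow> ereal) \<Rightarrow> ('u \<times> 'v \<Rightarrow> real) \<Rightarrow>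
   real \<Rightarrow> real \<Rightarrow> nat \<Rightarrow> 'u \<times> 'v \<Rightarrow> nat \<Rightarrow> 'u \<times> 'v" where
  "sa_mgda_iterate f g \<phi> L\<^sub>v\<^sub>v \<tau> J x\<^sub>0 k = fst (run_state (sa_mgda f g \<phi> L\<^sub>v\<^sub>v \<tau> J x\<^sub>0 k) 0)"

definition sa_mgda_gradients ::
  "('u::euclidean_space \<Rightarrow> ereal) \<Rightarrow> ('v::euclidean_space \<Rightarrow> ereal) \<Rightarrow> ('u \<times> 'v \<Rightarrow> real) \<Rightarrow>
   real \<Rightarrow> real \<Rightarrow> nat \<Rightarrow> 'u \<times> 'v \<Rightarrow> nat \<Rightarrow> nat" where
  "sa_mgda_gradients f g \<phi> L\<^sub>v\<^sub>v \<tau> J x\<^sub>0 k = snd (run_state (sa_mgda f g \<phi> L\<^sub>v\<^sub>v \<tau> J x\<^sub>0 k) 0)"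

end

theory Submission
  imports Defs "HOL-Real_Asymp.Real_Asymp"
begin

text \<open>
  SA-MGDA is an inexact Bregman proximal point method with kernel \<open>h\<close>.  For fixed \<open>x\<close>, let \<open>u'\<close> be
  the \<open>u\<close>-part of the next iterate, let \<open>v'\<close> be the fixed point of the inner map and put
  \<open>z = (u', v')\<close>.  The optimality conditions of the two prox steps say exactly that
  \<open>\<nabla>h(x) - \<nabla>h(z) \<in> M z\<close> (\<open>exact_step_in_saddle_op\<close>), so the strong MVI condition and the
  three-point identity give
  \<open>D_h(x\<^sub>*, z) + \<mu> \<parallel>z - x\<^sub>*\<parallel>\<^sup>2 + D_h(z, x) \<le> D_h(x\<^sub>*, x)\<close>.
  Because \<open>\<tau> L < 1\<close>, \<open>D_h\<close> lies between two positive multiples of the squared distance.  Hence the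
  \<open>\<mu>\<close>-term turns the inequality into a linear decrease of \<open>D_h(x\<^sub>*, \<cdot>)\<close> along exact steps, by the
  factor \<open>1 / (1 + 2 \<mu> / H)\<close> with \<open>H = 1 / \<tau> + L\<close>.

  The inner map is itself a contraction.  Its prox is nonexpansive, and the argument of the prox has
  Lipschitz constant \<open>q = (2 L\<^sub>v\<^sub>v + 2 l') / (1 / \<tau> + 2 L\<^sub>v\<^sub>v)\<close>, where \<open>l' = min L L\<^sub>v\<^sub>v\<close>; this is
  below \<open>1\<close> since \<open>2 l' \<le> L + L\<^sub>v\<^sub>v < 1 / \<tau>\<close>.  After \<open>J\<close> inner iterations, started at the \<open>v\<close>-part of
  \<open>x\<close>, the computed point \<open>y\<close> therefore satisfies \<open>\<parallel>y - z\<parallel> \<le> q\<^sup>J \<parallel>x - z\<parallel>\<close>.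

  This error is relative to the length of the step, and both \<open>\<parallel>x - z\<parallel>\<^sup>2\<close> and \<open>\<parallel>z - x\<^sub>*\<parallel>\<^sup>2\<close> are
  bounded by multiples of \<open>D_h(x\<^sub>*, x)\<close>, by the same inequality.  The perturbation thus only adds
  a multiple of \<open>(q\<^sup>J)\<^sup>2 + 2 q\<^sup>J\<close> to the contraction factor (\<open>inexact_bregman_step\<close>).  A fixed \<open>J\<close>,
  independent of \<open>\<epsilon>\<close>, keeps the factor below \<open>1\<close>, and \<open>D_h(x\<^sub>*, x\<^sub>k)\<close> decays geometrically.
  With this \<open>J\<close> the \<open>O(log (1/\<epsilon>))\<close> outer iterations already cost only \<open>O(log (1/\<epsilon>))\<close> gradients, and
  the three bounds follow.
\<close>

section \<open>Proximal maps of closed proper convex functions\<close>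

lemma subdiff_monotone:
  assumes proper: "\<And>x. f x \<noteq> -\<infinity>" "edom f \<noteq> {}"
    and s: "s \<in> subdiff f x" and t: "t \<in> subdiff f y"
  shows "0 \<le> (s - t) \<bullet> (x - y)"
proof -
  obtain z where z: "f z < \<infinity>"
    using proper(2) by (auto simp: edom_def)
  have s': "f x + ereal (s \<bullet> (w - x)) \<le> f w" and t': "f y + ereal (t \<bullet> (w - y)) \<le> f w" for w
    using s t by (auto simp: subdiff_def)
  have "f x \<noteq> \<infinity>" "f y \<noteq> \<infinity>"
    using s'[of z] t'[of z] z by auto
  then obtain a b where "f x = ereal a" "f y = ereal b"
    using proper(1) by (meson ereal_cases)
  with s'[of y] t'[of x] show ?thesis
    by (auto simp: inner_diff_left inner_diff_right)
qed

text \<open>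
  The point \<open>(x\<^sub>0, f(x\<^sub>0) - 1)\<close> lies below the epigraph.  A hyperplane strictly separating the
  two cannot be vertical, since \<open>(x\<^sub>0, f(x\<^sub>0))\<close> belongs to the epigraph and lies on the same vertical
  line; so it is the graph of an affine function below \<open>f\<close>.
\<close>

lemma affine_minorant:
  fixes f :: "'a::euclidean_space \<Rightarrow> ereal"
  assumes "closed_proper_convex f"
  shows "\<exists>a c. \<forall>(x, r) \<in> epi f. c + a \<bullet> x \<le> r"
proof -
  have cl: "closed (epi f)" and cv: "convex (epi f)" and fin: "\<And>x. f x \<noteq> -\<infinity>"
    using assms by (auto simp: closed_proper_convex_def)
  obtain x0 where "f x0 < \<infinity>"
    using assms by (auto simp: closed_proper_convex_def edom_def)
  then obtain r0 where r0: "f x0 = ereal r0"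
    using fin by (metis ereal_cases less_ereal.simps(2))
  have "(x0, r0 - 1) \<notin> epi f" by (auto simp: epi_def r0)
  from separating_hyperplane_closed_point[OF cv cl this]
  obtain p b where p: "p \<bullet> (x0, r0 - 1) < b" "\<And>z. z \<in> epi f \<Longrightarrow> p \<bullet> z > b"
    by blast
  obtain a \<beta> where ab: "p = (a, \<beta>)" by (cases p)
  have "(x0, r0) \<in> epi f" by (auto simp: epi_def r0)
  from p(2)[OF this] p(1) have \<beta>: "\<beta> > 0"
    by (auto simp: ab inner_prod_def algebra_simps)
  have "b / \<beta> + ((- 1 / \<beta>) *\<^sub>R a) \<bullet> x \<le> r" if "(x, r) \<in> epi f" for x r
    using p(2)[OF that] \<beta> by (simp add: ab inner_prod_def field_simps)
  then show ?thesis by blast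
qed

text \<open>
  The point sought minimises \<open>\<psi>(x) + \<parallel>x - z\<parallel>\<^sup>2 / 2\<close>.  Since \<open>\<psi>\<close> is only lower semicontinuous, the
  minimisation is carried out over the epigraph, where the objective \<open>r + \<parallel>x - z\<parallel>\<^sup>2 / 2\<close> is
  continuous; the affine minorant makes its sublevel sets bounded.  Comparing the minimiser with
  nearby points of segments in the epigraph gives the subgradient.
\<close>

lemma resolvent_exists:
  fixes \<psi> :: "'a::euclidean_space \<Rightarrow> ereal"
  assumes "closed_proper_convex \<psi>"
  shows "\<exists>p. \<exists>s\<in>subdiff \<psi> p. z = p + s"
proof -
  have cl: "closed (epi \<psi>)" and cv: "convex (epi \<psi>)" and fin: "\<And>x. \<psi> x \<noteq> -\<infinity>"
    using assms by (auto simp: closed_proper_convex_def)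
  obtain x0 where "\<psi> x0 < \<infinity>"
    using assms by (auto simp: closed_proper_convex_def edom_def)
  then obtain r0 where r0: "\<psi> x0 = ereal r0"
    using fin by (metis ereal_cases less_ereal.simps(2))
  obtain a c where ac: "\<And>x r. (x, r) \<in> epi \<psi> \<Longrightarrow> c + a \<bullet> x \<le> r"
    using affine_minorant[OF assms] by blast
  define F where "F = (\<lambda>(x, r). r + (norm (x - z))\<^sup>2 / 2 :: real)"
  have contF: "continuous_on UNIV F"
    unfolding F_def case_prod_beta by (intro continuous_intros) simp
  define C where "C = F (x0, r0)"
  define S where "S = epi \<psi> \<inter> {w. F w \<le> C}"
  define B where "B = \<bar>C - c - a \<bullet> z\<bar>"
  \<comment> \<open>Chosen so that \<open>s (s / 2 - \<parallel>a\<parallel>) > B\<close> for all \<open>s > R\<close>.\<close>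
  define R where "R = 1 + 2 * norm a + 2 * B"
  have xb: "norm (x - z) \<le> R" and rb: "\<bar>r\<bar> \<le> \<bar>C\<bar> + \<bar>c + a \<bullet> z\<bar> + norm a * R"
    if "(x, r) \<in> S" for x r
  proof -
    let ?s = "norm (x - z)"
    have 1: "c + a \<bullet> x \<le> r" and 2: "r + ?s\<^sup>2 / 2 \<le> C"
      using that ac by (auto simp: S_def F_def)
    have 3: "a \<bullet> x \<ge> a \<bullet> z - norm a * ?s"
      using Cauchy_Schwarz_ineq2[of a "x - z"] by (auto simp: inner_diff_right)
    have 4: "?s * (?s / 2 - norm a) \<le> B"
    proof -
      have "?s * (?s / 2 - norm a) = ?s\<^sup>2 / 2 - norm a * ?s"
        by (simp add: power2_eq_square algebra_simps)
      with 1 2 3 show ?thesis unfolding B_def by linarith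
    qed
    show 5: "?s \<le> R"
    proof (rule ccontr)
      assume "\<not> ?s \<le> R"
      then have g: "?s > R" by simp
      have "B \<ge> 0" by (simp add: B_def)
      then have "?s \<ge> 1" "?s / 2 - norm a > B"
        using g by (auto simp: R_def intro: order_trans[of _ R])
      then have "B < 1 * (?s / 2 - norm a)" by simp
      also have "\<dots> \<le> ?s * (?s / 2 - norm a)"
        using \<open>?s \<ge> 1\<close> \<open>B \<ge> 0\<close> \<open>?s / 2 - norm a > B\<close> by (intro mult_right_mono) auto
      finally show False using 4 by simp
    qed
    have "norm a * ?s \<le> norm a * R" using 5 by (simp add: mult_left_mono)
    moreover have "0 \<le> ?s\<^sup>2" "0 \<le> norm a * ?s" by simp_all
    ultimately show "\<bar>r\<bar> \<le> \<bar>C\<bar> + \<bar>c + a \<bullet> z\<bar> + norm a * R"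
      using 1 2 3 by linarith
  qed
  have "S \<subseteq> cball z R \<times> {- (\<bar>C\<bar> + \<bar>c + a \<bullet> z\<bar> + norm a * R) .. \<bar>C\<bar> + \<bar>c + a \<bullet> z\<bar> + norm a * R}"
    using xb rb by (fastforce simp: dist_norm norm_minus_commute)
  then have "bounded S"
    by (rule bounded_subset[rotated]) (intro bounded_Times bounded_cball bounded_closed_interval)
  moreover have "closed S"
    unfolding S_def by (intro closed_Int cl closed_Collect_le contF continuous_on_const)
  ultimately have "compact S" by (simp add: compact_eq_bounded_closed)
  moreover have "(x0, r0) \<in> S" by (simp add: S_def C_def epi_def r0)
  ultimately obtain w where w: "w \<in> S" "\<And>y. y \<in> S \<Longrightarrow> F w \<le> F y"
    using continuous_attains_inf[of S F] contF continuous_on_subset by blast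
  obtain p r where pr: "w = (p, r)" by (cases w)
  have min: "F (p, r) \<le> F y" if "y \<in> epi \<psi>" for y
    using that w by (cases "F y \<le> C") (auto simp: S_def pr)
  have pe: "(p, r) \<in> epi \<psi>" using w by (auto simp: S_def pr)
  have key: "r + (z - p) \<bullet> (y - p) \<le> t" if yt: "(y, t) \<in> epi \<psi>" for y t
  proof -
    have "0 \<le> (t - r) + (p - z) \<bullet> (y - p) + l * ((norm (y - p))\<^sup>2 / 2)"
      if l: "0 < l" "l < 1" for l :: real
    proof -
      have "(1 - l) *\<^sub>R (p, r) + l *\<^sub>R (y, t) \<in> epi \<psi>"
        using convexD[OF cv pe yt] l by auto
      from min[OF this]
      have "r + (norm (p - z))\<^sup>2 / 2 \<le>
          (1 - l) * r + l * t + (norm ((p - z) + l *\<^sub>R (y - p)))\<^sup>2 / 2"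
        by (simp add: F_def algebra_simps)
      moreover have "(norm ((p - z) + l *\<^sub>R (y - p)))\<^sup>2
          = (norm (p - z))\<^sup>2 + 2 * l * ((p - z) \<bullet> (y - p)) + l\<^sup>2 * (norm (y - p))\<^sup>2"
        using dot_norm[of "p - z" "l *\<^sub>R (y - p)"] by (simp add: power_mult_distrib)
      ultimately have "0 \<le> l * ((t - r) + (p - z) \<bullet> (y - p) + l * ((norm (y - p))\<^sup>2 / 2))"
        by (simp add: power2_eq_square algebra_simps)
      with l show ?thesis by (simp add: zero_le_mult_iff)
    qed
    then have ev: "eventually (\<lambda>l. 0 \<le> (t - r) + (p - z) \<bullet> (y - p) + l * ((norm (y - p))\<^sup>2 / 2))
        (at_right (0::real))"
      by (auto simp: eventually_at_right_field intro!: exI[of _ 1])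
    have lim: "((\<lambda>l. (t - r) + (p - z) \<bullet> (y - p) + l * ((norm (y - p))\<^sup>2 / 2)) \<longlongrightarrow>
        (t - r) + (p - z) \<bullet> (y - p) + 0 * ((norm (y - p))\<^sup>2 / 2)) (at_right (0::real))"
      by (intro tendsto_intros)
    have "0 \<le> (t - r) + (p - z) \<bullet> (y - p)"
      using tendsto_lowerbound[OF lim ev] by simp
    then show ?thesis by (simp add: inner_diff_left)
  qed
  have "\<psi> p + ereal ((z - p) \<bullet> (y - p)) \<le> \<psi> y" for y
  proof (cases "\<psi> y")
    case (real t)
    then have "r + (z - p) \<bullet> (y - p) \<le> t" by (intro key) (simp add: epi_def)
    then have "ereal r + ereal ((z - p) \<bullet> (y - p)) \<le> \<psi> y" by (simp add: real)
    moreover have "\<psi> p \<le> ereal r" using pe by (simp add: epi_def)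
    ultimately show ?thesis by (meson add_right_mono order_trans)
  qed (use fin in auto)
  then have "z - p \<in> subdiff \<psi> p" by (auto simp: subdiff_def)
  then show ?thesis by (intro exI[of _ p] bexI[of _ "z - p"]) auto
qed

text \<open>
  Stated for arbitrary subgradients, the estimate also yields uniqueness of the resolvent value.
\<close>

lemma resolvent_nonexpansive:
  fixes \<psi> :: "'a::euclidean_space \<Rightarrow> ereal"
  assumes "closed_proper_convex \<psi>" "s \<in> subdiff \<psi> p" "t \<in> subdiff \<psi> q"
  shows "norm (p - q) \<le> norm ((p + s) - (q + t))"
proof -
  have "0 \<le> (s - t) \<bullet> (p - q)"
    using assms by (intro subdiff_monotone[of \<psi>]) (auto simp: closed_proper_convex_def)
  then have "(p - q) \<bullet> (p - q) \<le> ((p + s) - (q + t)) \<bullet> (p - q)"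
    by (simp add: inner_diff_left inner_add_left)
  also have "\<dots> \<le> norm ((p + s) - (q + t)) * norm (p - q)"
    by (rule norm_cauchy_schwarz)
  finally have "norm (p - q) * norm (p - q) \<le> norm ((p + s) - (q + t)) * norm (p - q)"
    by (simp add: power2_norm_eq_inner[symmetric] power2_eq_square)
  then show ?thesis by (cases "p = q") auto
qed

lemma prox_subdiff:
  fixes \<psi> :: "'a::euclidean_space \<Rightarrow> ereal"
  assumes "closed_proper_convex \<psi>"
  shows "z - prox \<psi> z \<in> subdiff \<psi> (prox \<psi> z)"
proof -
  have "\<exists>!p. \<exists>s\<in>subdiff \<psi> p. z = p + s"
  proof (rule ex_ex1I[OF resolvent_exists[OF assms]])
    fix p q assume "\<exists>s\<in>subdiff \<psi> p. z = p + s" "\<exists>s\<in>subdiff \<psi> q. z = q + s"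
    then obtain s t where "s \<in> subdiff \<psi> p" "z = p + s" "t \<in> subdiff \<psi> q" "z = q + t" by blast
    with resolvent_nonexpansive[OF assms, of s p t q] show "p = q" by simp
  qed
  from theI'[OF this] show ?thesis
    unfolding prox_def[symmetric] by (metis add_diff_cancel_left')
qed

lemma prox_nonexpansive:
  fixes \<psi> :: "'a::euclidean_space \<Rightarrow> ereal"
  assumes "closed_proper_convex \<psi>"
  shows "norm (prox \<psi> y - prox \<psi> z) \<le> norm (y - z)"
  using resolvent_nonexpansive[OF assms prox_subdiff[OF assms, of y] prox_subdiff[OF assms, of z]]
  by simp

lemma ereal_scale_le_iff:
  assumes "0 < c"
  shows "ereal c * x \<le> ereal c * y \<longleftrightarrow> x \<le> y"
  using assms by (cases x; cases y) auto

lemma closed_proper_convex_scale: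
  fixes f :: "'a::euclidean_space \<Rightarrow> ereal"
  assumes "closed_proper_convex f" "0 < c"
  shows "closed_proper_convex (\<lambda>x. ereal c * f x)"
proof -
  have "ereal c * f x \<le> ereal r \<longleftrightarrow> f x \<le> ereal (r / c)" for x r
    using ereal_scale_le_iff[OF assms(2), of "f x" "ereal (r / c)"] assms(2) by simp
  then have epi: "epi (\<lambda>x. ereal c * f x) = (\<lambda>(x, r). (x, r / c)) -` epi f"
    by (auto simp: epi_def)
  have lin: "linear (\<lambda>(x::'a, r::real). (x, r / c))"
    by (rule linearI) (auto simp: add_divide_distrib)
  have fin: "ereal c * f x \<noteq> -\<infinity>" "ereal c * f x < \<infinity> \<longleftrightarrow> f x < \<infinity>" for x
    using assms by (cases "f x"; auto simp: closed_proper_convex_def)+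
  have dom: "edom (\<lambda>x. ereal c * f x) = edom f"
    unfolding edom_def fin(2) ..
  have "closed ((\<lambda>(x, r). (x, r / c)) -` epi f)"
    using assms by (intro closed_vimage linear_continuous_on linear_conv_bounded_linear[THEN iffD1] lin)
      (auto simp: closed_proper_convex_def)
  moreover have "convex ((\<lambda>(x, r). (x, r / c)) -` epi f)"
    using assms by (intro convex_linear_vimage lin) (auto simp: closed_proper_convex_def)
  ultimately show ?thesis
    using assms(1) unfolding closed_proper_convex_def epi dom by (auto simp only: fin)
qed

lemma subdiff_scaleD:
  assumes "0 < c" "s \<in> subdiff (\<lambda>x. ereal c * f x) p"
  shows "(1 / c) *\<^sub>R s \<in> subdiff f p"
proof -
  have "f p + ereal ((1 / c) *\<^sub>R s \<bullet> (y - p)) \<le> f y" for y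
  proof -
    have "ereal c * (f p + ereal ((1 / c) *\<^sub>R s \<bullet> (y - p))) = ereal c * f p + ereal (s \<bullet> (y - p))"
      using assms(1) by (cases "f p") (auto simp: algebra_simps)
    also have "\<dots> \<le> ereal c * f y"
      using assms(2) by (auto simp: subdiff_def)
    finally show ?thesis using ereal_scale_le_iff[OF assms(1)] by blast
  qed
  then show ?thesis by (simp add: subdiff_def)
qed

lemma prox_scaled_subdiff:
  fixes f :: "'a::euclidean_space \<Rightarrow> ereal"
  assumes "closed_proper_convex f" "0 < c" "p = prox (\<lambda>x. ereal c * f x) z"
  shows "(1 / c) *\<^sub>R (z - p) \<in> subdiff f p"
  unfolding assms(3)
  by (rule subdiff_scaleD[OF assms(2) prox_subdiff[OF closed_proper_convex_scale[OF assms(1,2)]]])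

section \<open>Bregman distances of smooth functions\<close>

lemma gderiv_grad:
  assumes "GDERIV F x :> D"
  shows "grad F x = D"
proof -
  have "D' = D" if "GDERIV F x :> D'" for D'
  proof -
    have "(\<lambda>h. h \<bullet> D') = (\<lambda>h. h \<bullet> D)"
      using has_derivative_unique that assms unfolding gderiv_def by blast
    then show ?thesis by (metis inner_commute vector_eq_rdot)
  qed
  with assms show ?thesis unfolding grad_def by blast
qed

lemma differentiable_gderiv:
  fixes F :: "'a::euclidean_space \<Rightarrow> real"
  assumes "F differentiable (at x)"
  shows "GDERIV F x :> grad F x"
proof -
  obtain F' where F': "(F has_derivative F') (at x)"
    using assms by (auto simp: differentiable_def)
  then have "linear F'" using has_derivative_linear by blast
  then have "F' h = h \<bullet> adjoint F' 1" for h
    by (metis adjoint_works inner_real_def mult.right_neutral)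
  then have "F' = (\<lambda>h. h \<bullet> adjoint F' 1)" by blast
  with F' have "GDERIV F x :> adjoint F' 1" by (simp add: gderiv_def)
  with gderiv_grad show ?thesis by metis
qed

lemma partial_gradients:
  fixes \<phi> :: "'u::euclidean_space \<times> 'v::euclidean_space \<Rightarrow> real"
  assumes "\<phi> differentiable (at x)"
  shows "grad_u \<phi> x = fst (grad \<phi> x)" "grad_v \<phi> x = snd (grad \<phi> x)"
proof -
  have d: "(\<phi> has_derivative (\<lambda>h. h \<bullet> grad \<phi> x)) (at (fst x, snd x))"
    using differentiable_gderiv[OF assms] by (simp add: gderiv_def)
  have "((\<lambda>u. \<phi> (u, snd x)) has_derivative (\<lambda>h. (h, 0) \<bullet> grad \<phi> x)) (at (fst x))"
    by (rule has_derivative_compose[where f = "\<lambda>u. (u, snd x)", OF _ d])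
      (auto intro!: derivative_eq_intros)
  then have "GDERIV (\<lambda>u. \<phi> (u, snd x)) (fst x) :> fst (grad \<phi> x)"
    by (simp add: gderiv_def inner_prod_def)
  then show "grad_u \<phi> x = fst (grad \<phi> x)" by (simp add: grad_u_def gderiv_grad)
  have "((\<lambda>v. \<phi> (fst x, v)) has_derivative (\<lambda>h. (0, h) \<bullet> grad \<phi> x)) (at (snd x))"
    by (rule has_derivative_compose[where f = "\<lambda>v. (fst x, v)", OF _ d])
      (auto intro!: derivative_eq_intros)
  then have "GDERIV (\<lambda>v. \<phi> (fst x, v)) (snd x) :> snd (grad \<phi> x)"
    by (simp add: gderiv_def inner_prod_def)
  then show "grad_v \<phi> x = snd (grad \<phi> x)" by (simp add: grad_v_def gderiv_grad)
qed

text \<open>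
  The descent lemma: along the segment from \<open>y\<close> to \<open>x\<close>, the difference of the two sides has
  nonpositive derivative, because \<open>G\<close> moves by at most \<open>L t \<parallel>x - y\<parallel>\<close> up to time \<open>t\<close>.
\<close>

lemma bregman_upper:
  fixes F :: "'a::euclidean_space \<Rightarrow> real"
  assumes D: "\<And>x. GDERIV F x :> G x" and L: "L-lipschitz_on UNIV G"
  shows "F x - F y - G y \<bullet> (x - y) \<le> L / 2 * (norm (x - y))\<^sup>2"
proof -
  define d where "d = x - y"
  define \<gamma> where "\<gamma> t = F (y + t *\<^sub>R d) - t * (G y \<bullet> d) - L / 2 * t\<^sup>2 * (norm d)\<^sup>2" for t
  have deriv: "\<exists>z. DERIV \<gamma> t :> z \<and> z \<le> 0" if "0 \<le> t" "t \<le> 1" for t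
  proof -
    have "((\<lambda>t. F (y + t *\<^sub>R d)) has_derivative (\<lambda>h. (h *\<^sub>R d) \<bullet> G (y + t *\<^sub>R d))) (at t)"
      by (rule has_derivative_compose[where f = "\<lambda>t. y + t *\<^sub>R d", OF _ D[unfolded gderiv_def]])
        (auto intro!: derivative_eq_intros)
    then have "((\<lambda>t. F (y + t *\<^sub>R d)) has_real_derivative d \<bullet> G (y + t *\<^sub>R d)) (at t)"
      by (simp add: has_field_derivative_def mult_commute_abs)
    then have "DERIV \<gamma> t :> d \<bullet> G (y + t *\<^sub>R d) - G y \<bullet> d - L * t * (norm d)\<^sup>2"
      unfolding \<gamma>_def by (auto intro!: derivative_eq_intros)
    moreover have "d \<bullet> (G (y + t *\<^sub>R d) - G y) \<le> norm d * (L * (t * norm d))"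
    proof (rule order_trans[OF norm_cauchy_schwarz mult_left_mono])
      show "norm (G (y + t *\<^sub>R d) - G y) \<le> L * (t * norm d)"
        using lipschitz_onD[OF L, of "y + t *\<^sub>R d" y] that by (simp add: dist_norm)
    qed simp
    ultimately show ?thesis
      by (auto simp: inner_diff_right inner_commute power2_eq_square algebra_simps)
  qed
  have "\<gamma> 1 \<le> \<gamma> 0"
    by (rule DERIV_nonpos_imp_nonincreasing[OF zero_le_one deriv])
  then show ?thesis by (simp add: \<gamma>_def d_def)
qed

lemma bregman_abs_le:
  fixes F :: "'a::euclidean_space \<Rightarrow> real"
  assumes D: "\<And>x. GDERIV F x :> G x" and L: "L-lipschitz_on UNIV G"
  shows "\<bar>F x - F y - G y \<bullet> (x - y)\<bar> \<le> L / 2 * (norm (x - y))\<^sup>2"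
proof -
  have "GDERIV (\<lambda>x. - F x) x :> - G x" for x
    using D[of x] by (auto simp: gderiv_def intro!: derivative_eq_intros)
  moreover have "L-lipschitz_on UNIV (\<lambda>x. - G x)"
    using L by (simp add: lipschitz_on_minus)
  ultimately have "- F x - - F y - - G y \<bullet> (x - y) \<le> L / 2 * (norm (x - y))\<^sup>2"
    by (rule bregman_upper)
  with bregman_upper[OF D L, of x y] show ?thesis
    unfolding inner_minus_left by linarith
qed

lemma gderiv_h_fun:
  fixes \<phi> :: "'u::euclidean_space \<times> 'v::euclidean_space \<Rightarrow> real"
  assumes "\<phi> differentiable (at x)"
  shows "GDERIV (h_fun \<tau> \<phi>) x :> (1 / \<tau>) *\<^sub>R x - grad \<phi> x"
proof -
  have "h_fun \<tau> \<phi> = (\<lambda>x. 1 / (2 * \<tau>) * (x \<bullet> x) - \<phi> x)"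
    by (auto simp: h_fun_def fun_eq_iff power2_norm_eq_inner inner_prod_def)
  moreover have "((\<lambda>x. c * (x \<bullet> x) - \<phi> x) has_derivative
      (\<lambda>h. h \<bullet> ((2 * c) *\<^sub>R x - grad \<phi> x))) (at x)" for c
    using differentiable_gderiv[OF assms] unfolding gderiv_def
    by (auto intro!: derivative_eq_intros simp: inner_diff_right inner_commute fun_eq_iff)
  from this[of "1 / (2 * \<tau>)"] have "((\<lambda>x. 1 / (2 * \<tau>) * (x \<bullet> x) - \<phi> x) has_derivative
      (\<lambda>h. h \<bullet> ((1 / \<tau>) *\<^sub>R x - grad \<phi> x))) (at x)" by simp
  ultimately show ?thesis by (simp add: gderiv_def)
qed

text \<open>
  Since \<open>h\<close> differs from \<open>\<parallel>\<cdot>\<parallel>\<^sup>2 / (2 \<tau>)\<close> by \<open>\<phi>\<close>, its Bregman distance differs from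
  \<open>\<parallel>x - y\<parallel>\<^sup>2 / (2 \<tau>)\<close> by that of \<open>\<phi>\<close>, which is at most \<open>L \<parallel>x - y\<parallel>\<^sup>2 / 2\<close> in absolute value.
\<close>

lemma bregman_h_bounds:
  fixes \<phi> :: "'u::euclidean_space \<times> 'v::euclidean_space \<Rightarrow> real"
  assumes diff: "\<And>x. \<phi> differentiable (at x)" and L: "L-lipschitz_on UNIV (grad \<phi>)"
  shows "(1 / \<tau> - L) / 2 * (norm (x - y))\<^sup>2 \<le> bregman (h_fun \<tau> \<phi>) x y"
    and "bregman (h_fun \<tau> \<phi>) x y \<le> (1 / \<tau> + L) / 2 * (norm (x - y))\<^sup>2"
proof -
  have g: "grad (h_fun \<tau> \<phi>) y = (1 / \<tau>) *\<^sub>R y - grad \<phi> y"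
    by (rule gderiv_grad[OF gderiv_h_fun[OF diff]])
  have h: "h_fun \<tau> \<phi> z = 1 / (2 * \<tau>) * (z \<bullet> z) - \<phi> z" for z
    by (cases z) (simp add: h_fun_def power2_norm_eq_inner inner_prod_def)
  let ?n = "(norm (x - y))\<^sup>2" and ?d = "\<phi> x - \<phi> y - grad \<phi> y \<bullet> (x - y)"
  define c where "c = 1 / (2 * \<tau>)"
  have c: "1 / \<tau> = 2 * c" by (simp add: c_def)
  have eq: "bregman (h_fun \<tau> \<phi>) x y = c * ?n - ?d"
    unfolding bregman_def g h power2_norm_eq_inner c_def[symmetric] c
    by (simp add: inner_diff_left inner_diff_right inner_commute algebra_simps)
  have "\<bar>?d\<bar> \<le> L / 2 * ?n"
    by (rule bregman_abs_le[OF differentiable_gderiv[OF diff] L])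
  then have d: "?d \<le> L / 2 * ?n" "- ?d \<le> L / 2 * ?n"
    unfolding abs_le_iff by blast+
  have "(2 * c - L) / 2 * ?n = c * ?n - L / 2 * ?n"
    by (simp add: diff_divide_distrib left_diff_distrib)
  also have "\<dots> \<le> c * ?n - ?d" by (rule diff_left_mono[OF d(1)])
  finally show "(1 / \<tau> - L) / 2 * ?n \<le> bregman (h_fun \<tau> \<phi>) x y"
    unfolding eq c .
  have "c * ?n - ?d \<le> c * ?n + L / 2 * ?n"
    using add_left_mono[OF d(2)] by simp
  also have "\<dots> = (2 * c + L) / 2 * ?n"
    by (simp add: add_divide_distrib distrib_right)
  finally show "bregman (h_fun \<tau> \<phi>) x y \<le> (1 / \<tau> + L) / 2 * ?n"
    unfolding eq c .
qed

lemma three_point_identity: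
  "(grad h y - grad h z) \<bullet> (x - z) = bregman h x z + bregman h z y - bregman h x y"
  by (simp add: bregman_def inner_diff_left inner_diff_right algebra_simps)

section \<open>The inner iteration\<close>

definition inner_map ::
  "('v::euclidean_space \<Rightarrow> ereal) \<Rightarrow> ('u::euclidean_space \<times> 'v \<Rightarrow> real) \<Rightarrow> real \<Rightarrow> real \<Rightarrow>
   'u \<times> 'v \<Rightarrow> 'u \<Rightarrow> 'v \<Rightarrow> 'v" where
  "inner_map g \<phi> l \<tau> x u' w =
     (let \<eta> = \<tau> / (1 + 2 * l * \<tau>) in
      prox (\<lambda>v. ereal \<eta> * g v)
        ((\<eta> / \<tau>) *\<^sub>R (snd x - \<tau> *\<^sub>R grad_v \<phi> x)
         + (2 * \<eta> * l) *\<^sub>R (w + (1 / l) *\<^sub>R grad_v \<phi> (u', w))))"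

lemma run_inner_loop:
  "run_state (inner_loop g \<phi> l \<tau> x u' j) n = ((inner_map g \<phi> l \<tau> x u' ^^ j) (snd x), n + 2 * j)"
  by (induction j) (auto simp: evaluate_def inner_map_def Let_def)

text \<open>
  The prox is nonexpansive, so the contraction factor is the Lipschitz constant of its argument.
\<close>

lemma inner_map_lipschitz:
  assumes g: "closed_proper_convex g" and pos: "0 < l" "0 < \<tau>"
    and lip: "\<And>v w. norm (grad_v \<phi> (u', v) - grad_v \<phi> (u', w)) \<le> l' * norm (v - w)"
  shows "norm (inner_map g \<phi> l \<tau> x u' v - inner_map g \<phi> l \<tau> x u' w)
    \<le> (2 * l + 2 * l') / (1 / \<tau> + 2 * l) * norm (v - w)"
proof -
  define \<eta> where "\<eta> = \<tau> / (1 + 2 * l * \<tau>)"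
  define b where "b = grad_v \<phi> (u', v) - grad_v \<phi> (u', w)"
  have \<eta>: "\<eta> > 0" "\<eta> = 1 / (1 / \<tau> + 2 * l)"
    using pos by (auto simp: \<eta>_def field_simps add_pos_pos)
  let ?arg = "\<lambda>w. (\<eta> / \<tau>) *\<^sub>R (snd x - \<tau> *\<^sub>R grad_v \<phi> x)
         + (2 * \<eta> * l) *\<^sub>R (w + (1 / l) *\<^sub>R grad_v \<phi> (u', w))"
  have "norm (inner_map g \<phi> l \<tau> x u' v - inner_map g \<phi> l \<tau> x u' w) \<le> norm (?arg v - ?arg w)"
    unfolding inner_map_def \<eta>_def[symmetric] Let_def
    by (rule prox_nonexpansive[OF closed_proper_convex_scale[OF g \<eta>(1)]])
  also have "?arg v - ?arg w = (2 * \<eta>) *\<^sub>R (l *\<^sub>R (v - w) + b)"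
    using pos by (simp add: b_def algebra_simps)
  also have "norm \<dots> = 2 * \<eta> * norm (l *\<^sub>R (v - w) + b)"
    using \<eta>(1) by simp
  also have "\<dots> \<le> 2 * \<eta> * (l * norm (v - w) + l' * norm (v - w))"
    using \<eta>(1) pos lip[of v w]
    by (intro mult_left_mono order_trans[OF norm_triangle_ineq] add_mono) (auto simp: b_def)
  also have "\<dots> = (2 * l + 2 * l') / (1 / \<tau> + 2 * l) * norm (v - w)"
    unfolding \<eta>(2) by (simp add: algebra_simps)
  finally show ?thesis .
qed

text \<open>
  With \<open>1 / \<eta> = 1 / \<tau> + 2 l\<close>, the two occurrences of \<open>2 l v\<close> cancel at a fixed point, which leaves
  the optimality condition of the exact dual step.
\<close>

lemma inner_map_fixpoint_subdiff:
  assumes g: "closed_proper_convex g" and pos: "0 < l" "0 < \<tau>"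
    and fp: "inner_map g \<phi> l \<tau> x u' v = v"
  shows "(1 / \<tau>) *\<^sub>R (snd x - v) - grad_v \<phi> x + 2 *\<^sub>R grad_v \<phi> (u', v) \<in> subdiff g v"
proof -
  define \<eta> where "\<eta> = \<tau> / (1 + 2 * l * \<tau>)"
  have \<eta>: "\<eta> > 0" "1 / \<eta> = 1 / \<tau> + 2 * l"
    using pos by (auto simp: \<eta>_def field_simps add_pos_pos)
  let ?z = "(\<eta> / \<tau>) *\<^sub>R (snd x - \<tau> *\<^sub>R grad_v \<phi> x)
         + (2 * \<eta> * l) *\<^sub>R (v + (1 / l) *\<^sub>R grad_v \<phi> (u', v))"
  have "v = prox (\<lambda>v. ereal \<eta> * g v) ?z"
    using fp unfolding inner_map_def \<eta>_def[symmetric] Let_def by (rule sym)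
  from prox_scaled_subdiff[OF g \<eta>(1) this]
  have "(1 / \<eta>) *\<^sub>R ?z - (1 / \<eta>) *\<^sub>R v \<in> subdiff g v"
    by (simp only: scaleR_diff_right)
  moreover have "(1 / \<eta>) *\<^sub>R ?z = (1 / \<tau>) *\<^sub>R snd x - grad_v \<phi> x
      + (2 * l) *\<^sub>R v + 2 *\<^sub>R grad_v \<phi> (u', v)"
    using \<eta>(1) pos by (simp add: scaleR_add_right scaleR_diff_right)
  moreover have "(1 / \<eta>) *\<^sub>R v = (1 / \<tau>) *\<^sub>R v + (2 * l) *\<^sub>R v"
    unfolding \<eta>(2) by (rule scaleR_left_distrib)
  ultimately show ?thesis
    by (simp only:) (simp add: algebra_simps)
qed

lemma contraction_iterates:
  fixes T :: "'a::banach \<Rightarrow> 'a"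
  assumes q: "0 \<le> q" "q < 1" and T: "\<And>v w. norm (T v - T w) \<le> q * norm (v - w)"
  obtains p where "T p = p" "\<And>j v. norm ((T ^^ j) v - p) \<le> q ^ j * norm (v - p)"
proof -
  have "\<exists>!p. T p = p"
    using T by (intro banach_fix_type[OF q]) (simp add: dist_norm)
  then obtain p where p: "T p = p" by blast
  have "norm ((T ^^ j) v - p) \<le> q ^ j * norm (v - p)" for j v
  proof (induction j)
    case (Suc j)
    have "norm ((T ^^ Suc j) v - p) \<le> q * norm ((T ^^ j) v - p)"
      using T[of "(T ^^ j) v" p] by (simp add: p)
    also have "\<dots> \<le> q * (q ^ j * norm (v - p))"
      by (rule mult_left_mono[OF Suc q(1)])
    finally show ?case by (simp add: mult.assoc)
  qed simp
  with p show ?thesis by (rule that)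
qed

section \<open>The outer iteration\<close>

definition outer_map ::
  "('u::euclidean_space \<Rightarrow> ereal) \<Rightarrow> ('v::euclidean_space \<Rightarrow> ereal) \<Rightarrow> ('u \<times> 'v \<Rightarrow> real) \<Rightarrow>
   real \<Rightarrow> real \<Rightarrow> nat \<Rightarrow> 'u \<times> 'v \<Rightarrow> 'u \<times> 'v" where
  "outer_map f g \<phi> l \<tau> J x =
     (let u' = prox (\<lambda>u. ereal \<tau> * f u) (fst x - \<tau> *\<^sub>R grad_u \<phi> x)
      in (u', (inner_map g \<phi> l \<tau> x u' ^^ J) (snd x)))"

lemma run_sa_mgda:
  "run_state (sa_mgda f g \<phi> l \<tau> J x\<^sub>0 k) n = ((outer_map f g \<phi> l \<tau> J ^^ k) x\<^sub>0, n + k * (1 + 2 * J))"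
  by (induction k) (auto simp: evaluate_def outer_map_def Let_def run_inner_loop)

text \<open>
  This identifies the method with a Bregman proximal point step.  The gradients at the old point
  enter through \<open>\<nabla>h(x)\<close>; the gradient at the new point is missing from the \<open>u\<close>-step and doubled in the
  \<open>v\<close>-step, as \<open>\<nabla>h\<close> contributes \<open>-\<nabla>\<phi>\<close> and \<open>M\<close> contributes \<open>(\<nabla>\<^sub>u\<phi>, -\<nabla>\<^sub>v\<phi>)\<close>.
\<close>

lemma exact_step_in_saddle_op:
  fixes f :: "'u::euclidean_space \<Rightarrow> ereal" and g :: "'v::euclidean_space \<Rightarrow> ereal"
  assumes f: "closed_proper_convex f" and g: "closed_proper_convex g"
    and diff: "\<And>x. \<phi> differentiable (at x)" and pos: "0 < l" "0 < \<tau>"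
    and u': "u' = prox (\<lambda>u. ereal \<tau> * f u) (fst x - \<tau> *\<^sub>R grad_u \<phi> x)"
    and v': "inner_map g \<phi> l \<tau> x u' v' = v'"
  shows "grad (h_fun \<tau> \<phi>) x - grad (h_fun \<tau> \<phi>) (u', v') \<in> saddle_op f g \<phi> (u', v')"
proof -
  define s where "s = (1 / \<tau>) *\<^sub>R (fst x - \<tau> *\<^sub>R grad_u \<phi> x - u')"
  define t where "t = (1 / \<tau>) *\<^sub>R (snd x - v') - grad_v \<phi> x + 2 *\<^sub>R grad_v \<phi> (u', v')"
  have "s \<in> subdiff f u'"
    unfolding s_def by (rule prox_scaled_subdiff[OF f pos(2) u'])
  moreover have "t \<in> subdiff g v'"
    unfolding t_def by (rule inner_map_fixpoint_subdiff[OF g pos v'])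
  moreover have gr: "grad (h_fun \<tau> \<phi>) y = (1 / \<tau>) *\<^sub>R y - grad \<phi> y" for y
    by (rule gderiv_grad[OF gderiv_h_fun[OF diff]])
  have "grad (h_fun \<tau> \<phi>) x - grad (h_fun \<tau> \<phi>) (u', v')
      = (grad_u \<phi> (u', v') + s, - grad_v \<phi> (u', v') + t)"
    unfolding gr using pos(2)
    by (simp add: prod_eq_iff s_def t_def partial_gradients[OF diff] algebra_simps scaleR_2)
  ultimately show ?thesis
    by (auto simp: saddle_op_def)
qed

text \<open>
  Here \<open>z\<close> is the exact step from \<open>x\<close> and \<open>y\<close> the computed one.  The change of \<open>D_h(x\<^sub>*, \<cdot>)\<close> from
  \<open>z\<close> to \<open>y\<close> is at most \<open>H e\<^sup>2 / 2 + H e \<parallel>z - x\<^sub>*\<parallel>\<close> with \<open>e = \<parallel>y - z\<parallel>\<close>.  An absolute error would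
  leave a residual; a relative one is absorbed by \<open>D_h(x\<^sub>*, x)\<close>, which dominates \<open>D_h(z, x)\<close> as
  well as \<open>D_h(x\<^sub>*, z)\<close>.
\<close>

lemma inexact_bregman_step:
  fixes h :: "'a::euclidean_space \<Rightarrow> real"
  assumes m: "0 < m" "0 < H" and \<mu>: "0 < \<mu>" and \<delta>: "0 \<le> \<delta>"
    and lower: "\<And>x y. m / 2 * (norm (x - y))\<^sup>2 \<le> bregman h x y"
    and upper: "\<And>x y. bregman h x y \<le> H / 2 * (norm (x - y))\<^sup>2"
    and lip: "\<And>x y. norm (grad h x - grad h y) \<le> H * norm (x - y)"
    and mvi: "\<mu> * (norm (z - xs))\<^sup>2 \<le> (z - xs) \<bullet> (grad h x - grad h z)"
    and err: "norm (y - z) \<le> \<delta> * norm (x - z)"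
  shows "bregman h xs y \<le> (1 / (1 + 2 * \<mu> / H) + H / m * (\<delta>\<^sup>2 + 2 * \<delta>)) * bregman h xs x"
proof -
  define D where "D = bregman h xs x"
  define a s e where "a = norm (z - xs)" and "s = norm (x - z)" and "e = norm (y - z)"
  have nn: "0 \<le> a" "0 \<le> s" "0 \<le> e" by (auto simp: a_def s_def e_def)
  have es: "e \<le> \<delta> * s" using err by (simp add: e_def s_def)
  have 1: "bregman h xs z + \<mu> * a\<^sup>2 + bregman h z x \<le> D"
    using mvi three_point_identity[of h x z xs] inner_minus_left[of "z - xs"]
    by (simp add: D_def a_def inner_commute inner_diff_left inner_diff_right)
  have a_lo: "m / 2 * a\<^sup>2 \<le> bregman h xs z" and a_up: "bregman h xs z \<le> H / 2 * a\<^sup>2"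
    using lower[of xs z] upper[of xs z] by (auto simp: a_def norm_minus_commute)
  have s_lo: "m / 2 * s\<^sup>2 \<le> bregman h z x"
    using lower[of z x] by (simp add: s_def norm_minus_commute)
  have sq: "0 \<le> m / 2 * a\<^sup>2" "0 \<le> m / 2 * s\<^sup>2" "0 \<le> \<mu> * a\<^sup>2" using m \<mu> by auto
  have a2: "a\<^sup>2 \<le> 2 * D / m" and s2: "s\<^sup>2 \<le> 2 * D / m"
  proof -
    have "m / 2 * a\<^sup>2 \<le> D" "m / 2 * s\<^sup>2 \<le> D" using 1 a_lo s_lo sq by linarith+
    then show "a\<^sup>2 \<le> 2 * D / m" "s\<^sup>2 \<le> 2 * D / m" using m by (auto simp: field_simps)
  qed
  have "2 * (s * a) \<le> s\<^sup>2 + a\<^sup>2"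
    using sum_squares_bound[of s a] by (simp add: power2_eq_square algebra_simps)
  then have sa: "s * a \<le> 2 * D / m" using a2 s2 by linarith
  have exact: "bregman h xs z \<le> 1 / (1 + 2 * \<mu> / H) * D"
  proof -
    have "2 * \<mu> / H * bregman h xs z \<le> 2 * \<mu> / H * (H / 2 * a\<^sup>2)"
      using m \<mu> by (intro mult_left_mono a_up) auto
    also have "\<dots> = \<mu> * a\<^sup>2" using m by simp
    finally have "(1 + 2 * \<mu> / H) * bregman h xs z \<le> D"
      using 1 s_lo sq by (simp add: distrib_right)
    moreover have "0 < 1 + 2 * \<mu> / H" using m \<mu> by (intro add_pos_pos) auto
    ultimately show ?thesis by (simp add: pos_le_divide_eq mult.commute)
  qed
  have "bregman h xs y = bregman h xs z + bregman h z y + (grad h z - grad h y) \<bullet> (xs - z)"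
    by (simp add: bregman_def inner_diff_left inner_diff_right algebra_simps)
  also have "bregman h z y \<le> H / 2 * e\<^sup>2"
    using upper[of z y] by (simp add: e_def norm_minus_commute)
  also have "(grad h z - grad h y) \<bullet> (xs - z) \<le> (H * e) * a"
    using lip[of z y] nn
    by (intro order_trans[OF norm_cauchy_schwarz] mult_mono)
      (auto simp: a_def e_def norm_minus_commute m less_imp_le)
  also have "H / 2 * e\<^sup>2 \<le> H / m * \<delta>\<^sup>2 * D"
  proof -
    have "e\<^sup>2 \<le> \<delta>\<^sup>2 * s\<^sup>2" using es nn by (metis power_mono power_mult_distrib)
    also have "\<dots> \<le> \<delta>\<^sup>2 * (2 * D / m)" by (intro mult_left_mono s2) simp
    finally have "H / 2 * e\<^sup>2 \<le> H / 2 * (\<delta>\<^sup>2 * (2 * D / m))" using m by (intro mult_left_mono) auto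
    then show ?thesis by (simp add: mult_ac)
  qed
  also have "H * e * a \<le> H / m * (2 * \<delta>) * D"
  proof -
    have "e * a \<le> \<delta> * (s * a)" using mult_right_mono[OF es nn(1)] by (simp add: mult.assoc)
    also have "\<dots> \<le> \<delta> * (2 * D / m)" by (intro mult_left_mono sa \<delta>)
    finally have "H * (e * a) \<le> H * (\<delta> * (2 * D / m))" using m by (intro mult_left_mono) auto
    then show ?thesis by (simp add: mult_ac)
  qed
  finally have "bregman h xs y \<le> bregman h xs z + H / m * \<delta>\<^sup>2 * D + H / m * (2 * \<delta>) * D" by simp
  with exact show ?thesis
    unfolding D_def[symmetric] by (simp add: distrib_left distrib_right)
qed

lemma norm_snd_component_le: "norm (snd x) \<le> norm x"
  by (metis norm_snd_le prod.collapse)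

lemma sa_mgda_step:
  fixes f :: "'u::euclidean_space \<Rightarrow> ereal" and g :: "'v::euclidean_space \<Rightarrow> ereal"
  assumes f: "closed_proper_convex f" and g: "closed_proper_convex g"
    and diff: "\<And>x. \<phi> differentiable (at x)" and L: "L-lipschitz_on UNIV (grad \<phi>)"
    and lip: "\<And>u v w. norm (grad_v \<phi> (u, v) - grad_v \<phi> (u, w)) \<le> l * norm (v - w)"
    and l: "0 < l" and \<tau>: "0 < \<tau>" "L + l < 1 / \<tau>" and \<mu>: "0 < \<mu>"
    and xs: "x\<^sub>s \<in> S_star \<mu> (saddle_op f g \<phi>)"
  shows "\<exists>q. 0 \<le> q \<and> q < 1 \<and> (\<forall>J x.
    bregman (h_fun \<tau> \<phi>) x\<^sub>s (outer_map f g \<phi> l \<tau> J x)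
      \<le> (1 / (1 + 2 * \<mu> / (1 / \<tau> + L)) + (1 / \<tau> + L) / (1 / \<tau> - L) * ((q ^ J)\<^sup>2 + 2 * q ^ J))
         * bregman (h_fun \<tau> \<phi>) x\<^sub>s x)"
proof -
  \<comment> \<open>The constant \<open>l\<close> alone is not enough: \<open>L + l < 1 / \<tau>\<close> does not imply \<open>2 l < 1 / \<tau>\<close>.\<close>
  define l' where "l' = min L l"
  define q where "q = (2 * l + 2 * l') / (1 / \<tau> + 2 * l)"
  have L0: "0 \<le> L" using lipschitz_on_nonneg[OF L] .
  have lip': "norm (grad_v \<phi> (u, v) - grad_v \<phi> (u, w)) \<le> l' * norm (v - w)" for u v w
  proof -
    have "norm (grad_v \<phi> (u, v) - grad_v \<phi> (u, w)) \<le> norm (grad \<phi> (u, v) - grad \<phi> (u, w))"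
      using norm_snd_component_le[of "grad \<phi> (u, v) - grad \<phi> (u, w)"] by (simp add: partial_gradients[OF diff])
    also have "\<dots> \<le> L * norm (v - w)"
      using lipschitz_onD[OF L, of "(u, v)" "(u, w)"] by (simp add: dist_norm norm_Pair)
    finally show ?thesis using lip[of u v w] by (simp add: l'_def min_def)
  qed
  have q: "0 \<le> q" "q < 1"
    using L0 l \<tau> by (auto simp: q_def l'_def add_pos_pos)
  have gr: "grad (h_fun \<tau> \<phi>) y = (1 / \<tau>) *\<^sub>R y - grad \<phi> y" for y
    by (rule gderiv_grad[OF gderiv_h_fun[OF diff]])
  have glip: "norm (grad (h_fun \<tau> \<phi>) x - grad (h_fun \<tau> \<phi>) y) \<le> (1 / \<tau> + L) * norm (x - y)" for x y
  proof -
    have "grad (h_fun \<tau> \<phi>) x - grad (h_fun \<tau> \<phi>) y = (1 / \<tau>) *\<^sub>R (x - y) - (grad \<phi> x - grad \<phi> y)"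
      by (simp add: gr algebra_simps)
    also have "norm \<dots> \<le> norm ((1 / \<tau>) *\<^sub>R (x - y)) + norm (grad \<phi> x - grad \<phi> y)"
      by (rule norm_triangle_ineq4)
    finally show ?thesis
      using lipschitz_onD[OF L, of x y] \<tau> by (simp add: dist_norm distrib_right)
  qed
  have step: "bregman (h_fun \<tau> \<phi>) x\<^sub>s (outer_map f g \<phi> l \<tau> J x)
      \<le> (1 / (1 + 2 * \<mu> / (1 / \<tau> + L)) + (1 / \<tau> + L) / (1 / \<tau> - L) * ((q ^ J)\<^sup>2 + 2 * q ^ J))
         * bregman (h_fun \<tau> \<phi>) x\<^sub>s x" for J x
  proof -
    define u' where "u' = prox (\<lambda>u. ereal \<tau> * f u) (fst x - \<tau> *\<^sub>R grad_u \<phi> x)"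
    let ?T = "inner_map g \<phi> l \<tau> x u'"
    have "norm (?T v - ?T w) \<le> q * norm (v - w)" for v w
      unfolding q_def by (rule inner_map_lipschitz[OF g l \<tau>(1) lip'])
    then obtain v' where v': "?T v' = v'" "\<And>j v. norm ((?T ^^ j) v - v') \<le> q ^ j * norm (v - v')"
      using contraction_iterates[OF q] by blast
    define z where "z = (u', v')"
    have "(z, grad (h_fun \<tau> \<phi>) x - grad (h_fun \<tau> \<phi>) z) \<in> gra (saddle_op f g \<phi>)"
      unfolding z_def gra_def
      using exact_step_in_saddle_op[OF f g diff l \<tau>(1) u'_def v'(1)] by simp
    then have mvi: "\<mu> * (norm (z - x\<^sub>s))\<^sup>2 \<le> (z - x\<^sub>s) \<bullet> (grad (h_fun \<tau> \<phi>) x - grad (h_fun \<tau> \<phi>) z)"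
      using xs by (auto simp: S_star_def dest!: bspec)
    have "outer_map f g \<phi> l \<tau> J x - z = (0, (?T ^^ J) (snd x) - v')"
      by (simp add: outer_map_def Let_def u'_def z_def)
    then have "norm (outer_map f g \<phi> l \<tau> J x - z) \<le> q ^ J * norm (snd x - v')"
      using v'(2) by (simp add: norm_Pair)
    also have "\<dots> \<le> q ^ J * norm (x - z)"
      using norm_snd_component_le[of "x - z"] q(1)
      by (intro mult_left_mono) (simp_all add: z_def)
    finally have err: "norm (outer_map f g \<phi> l \<tau> J x - z) \<le> q ^ J * norm (x - z)" .
    show ?thesis
      by (rule inexact_bregman_step[OF _ _ \<mu> _ bregman_h_bounds[OF diff L] glip mvi err])
        (use q L0 l \<tau> in \<open>auto intro: add_pos_nonneg\<close>)
  qed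
  from q step show ?thesis by blast
qed

section \<open>Iteration counts\<close>

lemma linear_rate_iteration_count:
  fixes \<rho> C :: real
  assumes \<rho>: "0 < \<rho>" "\<rho> < 1" and C: "0 < C"
  shows "\<exists>K :: real \<Rightarrow> nat. (\<forall>\<epsilon>>0. \<rho> ^ K \<epsilon> * C \<le> \<epsilon>) \<and>
    (\<lambda>\<epsilon>. real (K \<epsilon>)) \<in> O[at_right 0](\<lambda>\<epsilon>. ln (1 / \<epsilon>))"
proof -
  define c where "c = - ln \<rho>"
  have c: "c > 0" using \<rho> by (simp add: c_def)
  \<comment> \<open>For \<open>\<epsilon> > C\<close> the ceiling is at most zero and \<^const>\<open>nat\<close> truncates it to no iteration.\<close>
  define K where "K \<epsilon> = nat \<lceil>ln (C / \<epsilon>) / c\<rceil>" for \<epsilon>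
  have "\<rho> ^ K \<epsilon> * C \<le> \<epsilon>" if \<epsilon>: "\<epsilon> > 0" for \<epsilon>
  proof -
    have "ln (C / \<epsilon>) / c \<le> real (K \<epsilon>)" unfolding K_def by linarith
    then have "ln (C / \<epsilon>) \<le> real (K \<epsilon>) * c" using c by (simp add: field_simps)
    then have "ln (\<rho> ^ K \<epsilon> * C) \<le> ln \<epsilon>"
      using \<rho> C \<epsilon> by (simp add: ln_mult ln_realpow ln_div c_def)
    then show ?thesis using \<rho> C \<epsilon> by simp
  qed
  moreover have "(\<lambda>\<epsilon>. real (K \<epsilon>)) \<in> O[at_right 0](\<lambda>\<epsilon>. ln (C / \<epsilon>) / c + 1)"
  proof (rule landau_o.big_mono)
    have "eventually (\<lambda>\<epsilon>::real. 0 < \<epsilon> \<and> \<epsilon> < C) (at_right 0)"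
      using C by (auto simp: eventually_at_right_field)
    then show "eventually (\<lambda>\<epsilon>. norm (real (K \<epsilon>)) \<le> norm (ln (C / \<epsilon>) / c + 1)) (at_right 0)"
    proof eventually_elim
      case (elim \<epsilon>)
      then have "0 \<le> ln (C / \<epsilon>) / c" using c by (intro divide_nonneg_pos ln_ge_zero) auto
      then show ?case unfolding K_def real_norm_def by linarith
    qed
  qed
  moreover have "(\<lambda>\<epsilon>. ln (C / \<epsilon>) / c + 1) \<in> O[at_right 0](\<lambda>\<epsilon>. ln (1 / \<epsilon>))"
    using C c by real_asymp
  ultimately show ?thesis using landau_o.big_trans by blast
qed

section \<open>Complexity of SA-MGDA\<close>

theorem corollary5p7:
  fixes f :: "'u::euclidean_space \<Rightarrow> ereal"
    and g :: "'v::euclidean_space \<Rightarrow> ereal"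
    and \<phi> :: "'u \<times> 'v \<Rightarrow> real"
    and L\<^sub>u\<^sub>u L\<^sub>u\<^sub>v L\<^sub>v\<^sub>u L\<^sub>v\<^sub>v L \<Omega> \<mu> \<tau> :: real
    and x\<^sub>s x\<^sub>0 :: "'u \<times> 'v"
  assumes "composite_smooth f g \<phi> L\<^sub>u\<^sub>u L\<^sub>u\<^sub>v L\<^sub>v\<^sub>u L\<^sub>v\<^sub>v"
    and "L > 0" and "L-lipschitz_on UNIV (grad \<phi>)"
    and "\<Omega> \<ge> 0" and "bounded_domain f g \<Omega>"
    and "\<mu> > 0" and "strong_MVI \<mu> (saddle_op f g \<phi>)"
    and "0 < \<tau>" and "\<tau> < 1 / (L + max L\<^sub>u\<^sub>u L\<^sub>v\<^sub>v)"
    and "x\<^sub>s \<in> S_star \<mu> (saddle_op f g \<phi>)"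
  shows "\<exists>K J :: real \<Rightarrow> nat.
    (\<forall>\<epsilon>>0. J \<epsilon> \<ge> 1 \<and>
       bregman (h_fun \<tau> \<phi>) x\<^sub>s (sa_mgda_iterate f g \<phi> L\<^sub>v\<^sub>v \<tau> (J \<epsilon>) x\<^sub>0 (K \<epsilon>)) \<le> \<epsilon>) \<and>
    (\<lambda>\<epsilon>. real (K \<epsilon>)) \<in> O[at_right 0](\<lambda>\<epsilon>. ln (1 / \<epsilon>)) \<and>
    (\<lambda>\<epsilon>. real (J \<epsilon>)) \<in> O[at_right 0](\<lambda>\<epsilon>. ln (1 / \<epsilon>)) \<and>
    (\<lambda>\<epsilon>. real (sa_mgda_gradients f g \<phi> L\<^sub>v\<^sub>v \<tau> (J \<epsilon>) x\<^sub>0 (K \<epsilon>)))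
       \<in> O[at_right 0](\<lambda>\<epsilon>. (ln (1 / \<epsilon>))\<^sup>2)"
proof -
  have f: "closed_proper_convex f" and g: "closed_proper_convex g"
    and diff: "\<And>x. \<phi> differentiable (at x)" and Lvv: "L\<^sub>v\<^sub>v > 0"
    using assms(1) by (auto simp: composite_smooth_def)
  have lip: "norm (grad_v \<phi> (u, v) - grad_v \<phi> (u, w)) \<le> L\<^sub>v\<^sub>v * norm (v - w)" for u v w
    using assms(1) unfolding composite_smooth_def
    by (metis add_0 diff_self mult_zero_right norm_zero)
  have "L + max L\<^sub>u\<^sub>u L\<^sub>v\<^sub>v < 1 / \<tau>"
    using assms(2,8,9) Lvv by (simp add: field_simps add_pos_pos less_max_iff_disj)
  then have \<tau>: "L + L\<^sub>v\<^sub>v < 1 / \<tau>" by linarith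
  define m H D where "m = 1 / \<tau> - L" and "H = 1 / \<tau> + L" and "D = bregman (h_fun \<tau> \<phi>) x\<^sub>s"
  have mH: "m > 0" "H > 0"
    using \<tau> assms(2,8) Lvv by (auto simp: m_def H_def add_pos_pos)
  define \<theta> where "\<theta> \<delta> = 1 / (1 + 2 * \<mu> / H) + H / m * (\<delta>\<^sup>2 + 2 * \<delta>)" for \<delta>
  obtain q where q: "0 \<le> q" "q < 1"
    and step: "\<And>J x. D (outer_map f g \<phi> L\<^sub>v\<^sub>v \<tau> J x) \<le> \<theta> (q ^ J) * D x"
    using sa_mgda_step[OF f g diff assms(3) lip Lvv assms(8) \<tau> assms(6,10)]
    unfolding m_def H_def D_def \<theta>_def by blast
  have "(\<lambda>J. \<theta> (q ^ J)) \<longlonglongrightarrow> 1 / (1 + 2 * \<mu> / H) + H / m * (0\<^sup>2 + 2 * 0)"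
    unfolding \<theta>_def using q by (intro tendsto_intros LIMSEQ_power_zero) auto
  moreover have "1 / (1 + 2 * \<mu> / H) + H / m * (0\<^sup>2 + 2 * 0) < 1"
    using mH assms(6) by (simp add: divide_less_eq add_pos_pos)
  ultimately have "eventually (\<lambda>J. \<theta> (q ^ J) < 1 \<and> J \<ge> 1) sequentially"
    by (intro eventually_conj order_tendstoD(2) eventually_ge_at_top)
  then obtain J where J: "\<theta> (q ^ J) < 1" "J \<ge> 1"
    by (auto simp: eventually_sequentially)
  define \<rho> where "\<rho> = \<theta> (q ^ J)"
  have \<rho>: "0 < \<rho>" "\<rho> < 1"
    using J mH q assms(6) by (auto simp: \<rho>_def \<theta>_def intro!: add_pos_nonneg)
  have rate: "D ((outer_map f g \<phi> L\<^sub>v\<^sub>v \<tau> J ^^ k) x\<^sub>0) \<le> \<rho> ^ k * D x\<^sub>0" for k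
  proof (induction k)
    case (Suc k)
    show ?case
      using order_trans[OF step[of J] mult_left_mono[OF Suc]] \<rho> by (simp add: \<rho>_def mult.assoc)
  qed simp
  \<comment> \<open>The iteration count is taken for \<open>D x\<^sub>0 + 1\<close>, as \<open>D x\<^sub>0\<close> itself may vanish.\<close>
  have D0: "0 \<le> D x\<^sub>0"
    unfolding D_def using mH(1)
    by (intro order_trans[OF _ bregman_h_bounds(1)[OF diff assms(3)]]) (simp add: m_def)
  then obtain K :: "real \<Rightarrow> nat" where K: "\<And>\<epsilon>. \<epsilon> > 0 \<Longrightarrow> \<rho> ^ K \<epsilon> * (D x\<^sub>0 + 1) \<le> \<epsilon>"
    and KO: "(\<lambda>\<epsilon>. real (K \<epsilon>)) \<in> O[at_right 0](\<lambda>\<epsilon>. ln (1 / \<epsilon>))"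
    using linear_rate_iteration_count[OF \<rho>, of "D x\<^sub>0 + 1"] by auto
  have const: "(\<lambda>\<epsilon>. c) \<in> O[at_right 0](\<lambda>\<epsilon>. ln (1 / \<epsilon>))" for c :: real
    by real_asymp
  have "D (sa_mgda_iterate f g \<phi> L\<^sub>v\<^sub>v \<tau> J x\<^sub>0 (K \<epsilon>)) \<le> \<epsilon>" if "\<epsilon> > 0" for \<epsilon>
  proof -
    have "D (sa_mgda_iterate f g \<phi> L\<^sub>v\<^sub>v \<tau> J x\<^sub>0 (K \<epsilon>)) \<le> \<rho> ^ K \<epsilon> * D x\<^sub>0"
      using rate by (simp add: sa_mgda_iterate_def run_sa_mgda)
    also have "\<dots> \<le> \<rho> ^ K \<epsilon> * (D x\<^sub>0 + 1)" using \<rho> by (intro mult_left_mono) auto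
    finally show ?thesis using K[OF that] by simp
  qed
  moreover have "(\<lambda>\<epsilon>. real (sa_mgda_gradients f g \<phi> L\<^sub>v\<^sub>v \<tau> J x\<^sub>0 (K \<epsilon>)))
      \<in> O[at_right 0](\<lambda>\<epsilon>. (ln (1 / \<epsilon>))\<^sup>2)"
  proof -
    have "real (sa_mgda_gradients f g \<phi> L\<^sub>v\<^sub>v \<tau> J x\<^sub>0 (K \<epsilon>)) = real (K \<epsilon>) * (1 + 2 * real J)" for \<epsilon>
      by (simp add: sa_mgda_gradients_def run_sa_mgda algebra_simps)
    then show ?thesis
      unfolding power2_eq_square by (simp only: landau_o.big.mult[OF KO const])
  qed
  ultimately show ?thesis
    using J(2) KO const[of "real J"] unfolding D_def
    by (intro exI[of _ K] exI[of _ "\<lambda>_. J"] conjI allI impI) simp_all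
qed

end
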